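(* Let $p$ be a prime number and $k$ be a positive integer. Then $$|\nu_{p^k}| = k+\sum_{i=1}^{k}\sum_{j=1}^{p^i-1}\phi(j).$$ In particular, $|\nu_p| = 1+\sum_{j=1}^{p-1}\phi(j)$.
   Context: For a positive integer $n$, elements of $\mathbb{Z}_n$ are identified with their representatives $0,1,\dots,n-1$. An unordered pair $\{a,b\}$ with $0\le a,b<n$ ($a=b$ allowed) is called a gcd-pair in $\mathbb{Z}_n$ if $\gcd(a,b)$ divides $n$. Here $\gcd(0,a)=a$ and $\gcd(0,0)=0$, so $\{0,0\}$ is not a gcd-pair. $\nu_n$ denotes the set of all gcd-pairs in $\mathbb{Z}_n$. $\phi$ is Euler's totient function. *)

theory Defs
  imports "HOL-Number_Theory.Number_Theory"
begin

(* Elements of Z_n are identified with their representatives 0, ..., n - 1.  The unordered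
   pair {a, b} is the set {a, b}, so the pair {a, a} is the singleton {a}.  The condition does
   not depend on which element is called a, since gcd is symmetric. *)
definition gcd_pair :: "nat \<Rightarrow> nat set \<Rightarrow> bool" where
  "gcd_pair n P \<longleftrightarrow> (\<exists>a b. P = {a, b} \<and> a < n \<and> b < n \<and> gcd a b dvd n)"

definition gcd_pairs :: "nat \<Rightarrow> nat set set"  (\<open>\<nu>\<close>) where
  "\<nu> n = {P. gcd_pair n P}"

end

theory Submission
  imports Defs
begin

text \<open>
  A gcd-pair in \<open>\<int>\<^sub>n\<close> with gcd \<open>d\<close> is \<open>d\<close> times a coprime pair below \<open>m = n / d\<close>, and
  \<open>m > 1\<close> because the gcd of two numbers below \<open>n\<close> cannot be \<open>n\<close>. The coprime pairs below \<open>m\<close>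
  are counted by their larger element \<open>j\<close>, which contributes \<open>\<phi>(j)\<close> of them, apart from \<open>{0, 1}\<close>.
  For \<open>n = p\<^sup>k\<close> the possible \<open>m\<close> are \<open>p\<^sup>1, \<dots>, p\<^sup>k\<close>.
\<close>

text \<open>Sorting the entries gives each unordered pair exactly one representative, so
  cardinalities can be taken on plain tuples.\<close>

definition coprime_pairs :: "nat \<Rightarrow> (nat \<times> nat) set" where
  "coprime_pairs m = {(a, b). a \<le> b \<and> b < m \<and> coprime a b}"

lemma finite_coprime_pairs: "finite (coprime_pairs m)"
  by (rule finite_subset[of _ "{..<m} \<times> {..<m}"]) (auto simp: coprime_pairs_def)

lemma card_coprime_pairs:
  assumes "m > 1"
  shows "card (coprime_pairs m) = 1 + (\<Sum>j = 1..m - 1. totient j)"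
proof -
  let ?S = "SIGMA j:{1..m - 1}. totatives j"
  \<comment> \<open>\<open>totatives j\<close> contains only positive numbers, so a smaller element
    0 must be treated apart: \<open>coprime 0 b\<close> forces \<open>b = 1\<close>. The pair
    \<open>(1, 1)\<close> is covered by \<open>j = 1\<close>. The swap is needed because the Sigma
    type puts the larger element first.\<close>
  have eq: "coprime_pairs m = insert (0, 1) (prod.swap ` ?S)"
  proof (intro Set.set_eqI, clarify)
    fix a b
    show "(a, b) \<in> coprime_pairs m \<longleftrightarrow> (a, b) \<in> insert (0, 1) (prod.swap ` ?S)"
      using assms
      by (cases "a = 0")
        (auto simp: coprime_pairs_def totatives_def image_iff)
  qed
  have "card (prod.swap ` ?S) = (\<Sum>j = 1..m - 1. totient j)"
    by (subst card_image) (auto simp: totient_def)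
  moreover have "(0, 1) \<notin> prod.swap ` ?S"
    by (auto simp: totatives_def)
  ultimately show ?thesis
    unfolding eq by (subst card_insert_disjoint) auto
qed

lemma doubleton_ordered_eq:
  fixes a b c d :: "'a :: linorder"
  assumes "{a, b} = {c, d}" "a \<le> b" "c \<le> d"
  shows "a = c" "b = d"
  using assms by (auto simp: doubleton_eq_iff)

lemma bij_betw_gcd_pairs:
  assumes "n > 0"
  shows "bij_betw (\<lambda>(m, a, b). {n div m * a, n div m * b})
           (SIGMA m:{m. m dvd n \<and> m > 1}. coprime_pairs m) (\<nu> n)"
    (is "bij_betw ?f ?S _")
  unfolding bij_betw_def
proof
  show "inj_on ?f ?S"
  proof (rule inj_onI)
    fix s s' assume s: "s \<in> ?S" "s' \<in> ?S" "?f s = ?f s'"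
    obtain m a b where s_eq: "s = (m, a, b)"
      by (cases s)
    obtain m' a' b' where s'_eq: "s' = (m', a', b')"
      by (cases s')
    have m: "m dvd n" "m' dvd n"
      and ab: "(a, b) \<in> coprime_pairs m" "(a', b') \<in> coprime_pairs m'"
      and eq: "{n div m * a, n div m * b} = {n div m' * a', n div m' * b'}"
      using s unfolding s_eq s'_eq by (simp_all only: mem_Sigma_iff mem_Collect_eq prod.case)
    have e: "n div m * a = n div m' * a'" "n div m * b = n div m' * b'"
      using doubleton_ordered_eq[OF eq] ab by (auto simp: coprime_pairs_def)
    \<comment> \<open>Coprimality makes the gcd of the scaled pair equal to the scaling factor, so
      the image determines \<open>n div m\<close>, hence \<open>m\<close>, and then \<open>a\<close>
      and \<open>b\<close> by cancellation.\<close>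
    have "n div m = gcd (n div m * a) (n div m * b)"
      using ab by (simp add: coprime_pairs_def gcd_mult_left)
    also have "\<dots> = n div m'"
      unfolding e using ab by (simp add: coprime_pairs_def gcd_mult_left)
    finally have d: "n div m = n div m'" .
    have pos: "n div m \<noteq> 0"
      using m assms by (metis dvd_div_eq_0_iff less_not_refl)
    have "m * (n div m) = m' * (n div m)"
      using m d by (metis dvd_mult_div_cancel)
    then have "m = m'"
      using pos by (metis mult_cancel2)
    moreover have "a = a'" "b = b'"
      using e pos unfolding d by (metis mult_cancel1)+
    ultimately show "s = s'"
      unfolding s_eq s'_eq by (simp only:)
  qed
  show "?f ` ?S = \<nu> n"
  proof (intro equalityI subsetI)
    fix P assume "P \<in> ?f ` ?S"
    then obtain m a b where m: "m dvd n" "m > 1" and ab: "a \<le> b" "b < m" "coprime a b"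
      and P: "P = {n div m * a, n div m * b}"
      by (auto simp: coprime_pairs_def)
    obtain d where d: "n = m * d"
      using m by blast
    then have nm: "n div m = d" "d > 0"
      using m assms by auto
    have "d * a < n" "d * b < n"
      using ab nm by (auto simp: d mult.commute[of m])
    moreover have "gcd (d * a) (d * b) dvd n"
      using ab d by (simp add: gcd_mult_left)
    ultimately show "P \<in> \<nu> n"
      unfolding gcd_pairs_def gcd_pair_def P nm by blast
  next
    fix P assume "P \<in> \<nu> n"
    then obtain a0 b0 where P0: "P = {a0, b0}" "a0 < n" "b0 < n" "gcd a0 b0 dvd n"
      by (auto simp: gcd_pairs_def gcd_pair_def)
    define a b where "a = min a0 b0" and "b = max a0 b0"
    have P: "P = {a, b}" "a \<le> b" "b < n" "gcd a b dvd n"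
      using P0 by (auto simp: a_def b_def min_def max_def gcd.commute insert_commute)
    define d where "d = gcd a b"
    obtain m where m: "n = d * m"
      using P by (auto simp: d_def)
    \<comment> \<open>A zero gcd cannot divide \<open>n > 0\<close>; this excludes
      \<open>{0, 0}\<close> and allows cancelling \<open>d\<close>.\<close>
    have "d > 0" "m > 0"
      using m assms by auto
    obtain x y where xy: "a = d * x" "b = d * y"
      unfolding d_def by (meson dvdE gcd_dvd1 gcd_dvd2)
    have "d = d * gcd x y"
      using d_def unfolding xy by (simp add: gcd_mult_left)
    then have "coprime x y"
      using \<open>d > 0\<close> by (metis coprime_iff_gcd_eq_1 less_not_refl mult_cancel1 mult_1_right)
    have "x \<le> y" "y < m"
      using P \<open>d > 0\<close> by (auto simp: xy m)
    \<comment> \<open>For \<open>m = 1\<close> both \<open>x\<close> and \<open>y\<close> would be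
      0, which are not coprime.\<close>
    moreover have "m \<noteq> 1"
      using \<open>coprime x y\<close> \<open>x \<le> y\<close> \<open>y < m\<close> by auto
    moreover have "n div m = d"
      using m \<open>m > 0\<close> by simp
    ultimately show "P \<in> ?f ` ?S"
      using \<open>coprime x y\<close> \<open>m > 0\<close> m
      by (intro image_eqI[of _ _ "(m, x, y)"]) (auto simp: P xy coprime_pairs_def)
  qed
qed

lemma card_gcd_pairs:
  assumes "n > 0"
  shows "card (\<nu> n) = (\<Sum>m | m dvd n \<and> m > 1. 1 + (\<Sum>j = 1..m - 1. totient j))"
proof -
  have "finite {m. m dvd n \<and> m > 1}"
    using assms by (intro finite_subset[OF _ finite_divisors_nat[of n]]) auto
  then show ?thesis
    using bij_betw_same_card[OF bij_betw_gcd_pairs[OF assms]]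
    by (simp add: finite_coprime_pairs card_coprime_pairs)
qed

lemma card_gcd_pairs_prime_power:
  assumes "prime p"
  shows "card (\<nu> (p ^ k)) = k + (\<Sum>i = 1..k. \<Sum>j = 1..p ^ i - 1. totient j)"
proof -
  have p: "p > 1"
    using assms by (rule prime_gt_1_nat)
  \<comment> \<open>The exponents start at 1 because \<open>m > 1\<close> removes the divisor
    \<open>p ^ 0\<close>.\<close>
  have "{m. m dvd p ^ k \<and> m > 1} = (\<lambda>i. p ^ i) ` {1..k}"
  proof (intro Set.set_eqI iffI)
    fix m assume "m \<in> {m. m dvd p ^ k \<and> m > 1}"
    then obtain i where "m = p ^ i" "i \<le> k" "m > 1"
      using assms by (auto simp: divides_primepow_nat)
    then show "m \<in> (\<lambda>i. p ^ i) ` {1..k}"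
      by (cases "i = 0") auto
  next
    fix m assume "m \<in> (\<lambda>i. p ^ i) ` {1..k}"
    then obtain i where "m = p ^ i" "0 < i" "i \<le> k"
      by auto
    then show "m \<in> {m. m dvd p ^ k \<and> m > 1}"
      using one_less_power[OF p] by (simp add: le_imp_power_dvd)
  qed
  moreover have "inj_on (\<lambda>i. p ^ i) {1..k}"
    using p by (intro inj_onI) (simp only: power_inject_exp)
  ultimately have "card (\<nu> (p ^ k)) = (\<Sum>i = 1..k. 1 + (\<Sum>j = 1..p ^ i - 1. totient j))"
    using p by (simp add: card_gcd_pairs sum.reindex)
  \<comment> \<open>The summand 1 for exponent \<open>i\<close> stands for the pair
    \<open>{0, p ^ (k - i)}\<close>, the scaled \<open>{0, 1}\<close>; together these give the
    leading \<open>k\<close>.\<close>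
  then show ?thesis
    by (simp add: sum.distrib sum_Suc)
qed

theorem theorem3p1:
  fixes p k :: nat
  assumes "prime p" and "k > 0"
  shows "card (\<nu> (p ^ k)) = k + (\<Sum>i = 1..k. \<Sum>j = 1..p ^ i - 1. totient j) \<and>
         card (\<nu> p) = 1 + (\<Sum>j = 1..p - 1. totient j)"
  using card_gcd_pairs_prime_power[OF assms(1), of k]
    card_gcd_pairs_prime_power[OF assms(1), of 1] by simp

end
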